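(* Let $R$ be a commutative ring with unit and let $s:\mathbf{Z}_{\ge 0}\to R$ be a generalized $n$-series over $R$. Then the following hold. (1) (Pascal's identity) For all integers $n>k>0$, $$\binom{n}{k}_s=\binom{n-1}{k-1}_s+\frac{s(n)-s(k)}{s(n-k)}\binom{n-1}{k}_s .$$ (2) ($s$-binomial theorem) For all integers $n\ge 0$, as elements of $R[1/s][x,y]$, $$(x+y)^n_s=\sum_{k=0}^n\binom{n}{k}_s x^{n-k}y^k\,(0+1)^k_s .$$ (3) ($s$-Lucas theorem) Suppose that $s(1)=1$ and that $s(a+b)\equiv s(a)+s(b)\pmod{s(a)s(b)}$ for all $a,b\in\mathbf{Z}_{>0}$. Then for any prime $p$ and any nonnegative integers $n_1,n_0,k_1,k_0$ with $n_0,k_0<p$, $$\binom{n_1p+n_0}{k_1p+k_0}_s\equiv\binom{n_1}{k_1}\binom{n_0}{k_0}_s\pmod{s(p)},$$ where $\binom{n_1}{k_1}$ is the ordinary binomial coefficient. (4) ($s$-Vandermonde identity) For all $m,n,k\in\mathbf{Z}_{\ge 0}$ with $k\le m+n$, $$\binom{m+n}{k}_s=\sum_j\binom{m}{k-j}_s\,V_s(n,j;m,k),$$ where the sum is over all $j\in\mathbf{Z}$ with $0\le j\le n$ and $0\le k-j\le m$.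
   Context: Rings are commutative with unit. A generalized $n$-series (GNS) over $R$ is a function $s:\mathbf{Z}_{\ge 0}\to R$ such that $s(0)=0$; $s(n)$ is not a zero-divisor for any $n>0$; and $s(n-k)\mid s(n)-s(k)$ for all $n>k>0$. Write $R[1/s]=R[s(1)^{-1},s(2)^{-1},\dots]$ (a localization containing $R$). Set $0!_s=1$, $n!_s=\prod_{i=1}^n s(i)$, and $\binom{n}{k}_s=\frac{n!_s}{k!_s(n-k)!_s}$ for $0\le k\le n$, which lies in $R$ (as a subring of $R[1/s]$); set $\binom{n}{k}_s=0$ if $k<0$ or $k>n$. For $n>k\ge 0$ set $c_s(n,k)=\frac{s(n)-s(k)}{s(n-k)}\in R$. The $s$-derivative with respect to $x$ is the $R[1/s][y]$-linear map $\nabla_{s,x}:R[1/s][x,y]\to R[1/s][x,y]$ with $\nabla_{s,x}(x^n)=s(n)x^{n-1}$ (so $\nabla_{s,x}(1)=0$). The symbols $(x+y)^n_s$, $n\ge 0$, denote the unique polynomials in $R[1/s][x,y]$ such that: $(x+y)^0_s=1$; substituting $y=-x$ in $(x+y)^n_s$ gives $0$ for all $n>0$; and $\nabla_{s,x}(x+y)^n_s=s(n)(x+y)^{n-1}_s$ for $n>0$. (The expression $x+y$ is part of the notation, not a sum.) $(0+1)^k_s$ denotes the value of $(x+y)^k_s$ at $x=0$, $y=1$. For integers $m,n,k,j$ with $0\le j\le n$ and $0\le k-j\le m$, define $$V_s(n,j;m,k)=\sum_{m<i_1<i_2<\cdots<i_j\le m+n}\ \prod_{\ell=1}^{j}c_s\bigl(i_\ell,\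 i_\ell-(k-j+\ell)\bigr),$$ the sum being over strictly increasing integer sequences (for $j=0$ the value is $1$). *)

theory Defs
  imports "HOL-Computational_Algebra.Polynomial" "HOL-Computational_Algebra.Primes"
    "HOL-Library.FuncSet"
begin

section \<open>Non-zero-divisors and the total ring of fractions\<close>

definition nonzerodiv :: "'a::comm_ring_1 \<Rightarrow> bool" where
  "nonzerodiv a \<longleftrightarrow> (\<forall>b. a * b = 0 \<longrightarrow> b = 0)"

lemma nonzerodiv_1 [simp]: "nonzerodiv 1"
  by (simp add: nonzerodiv_def)

lemma nonzerodiv_mult: "nonzerodiv a \<Longrightarrow> nonzerodiv b \<Longrightarrow> nonzerodiv (a * b)"
  unfolding nonzerodiv_def by (metis mult.assoc)

lemma nonzerodiv_cancel: "nonzerodiv a \<Longrightarrow> a * b = a * c \<Longrightarrow> b = c"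
  unfolding nonzerodiv_def by (metis right_diff_distrib right_minus_eq)

text \<open>The type \<open>'a tfrac\<close> is the localization of the ring \<open>'a\<close> at all of its
  non-zero-divisors. (\<open>HOL-Computational_Algebra.Fraction_Field\<close> only covers integral domains.)
  Since a type cannot depend on \<open>s\<close>, the ring $R[1/s]$ is realized below as the
  subring \<open>loc s\<close> of this type.\<close>

definition tfrac_rel :: "'a::comm_ring_1 \<times> 'a \<Rightarrow> 'a \<times> 'a \<Rightarrow> bool" where
  "tfrac_rel x y \<longleftrightarrow>
     nonzerodiv (snd x) \<and> nonzerodiv (snd y) \<and> fst x * snd y = fst y * snd x"

lemma part_equivp_tfrac_rel: "part_equivp (tfrac_rel :: 'a::comm_ring_1 \<times> 'a \<Rightarrow> _)"
proof (rule part_equivpI)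
  show "\<exists>x :: 'a \<times> 'a. tfrac_rel x x"
    by (rule exI[of _ "(0, 1)"]) (simp add: tfrac_rel_def)
  show "symp (tfrac_rel :: 'a \<times> 'a \<Rightarrow> _)"
    by (auto intro: sympI simp: tfrac_rel_def)
  show "transp (tfrac_rel :: 'a \<times> 'a \<Rightarrow> _)"
  proof (rule transpI)
    fix x y z :: "'a \<times> 'a"
    assume "tfrac_rel x y" "tfrac_rel y z"
    then have nz: "nonzerodiv (snd x)" "nonzerodiv (snd y)" "nonzerodiv (snd z)"
      and e1: "fst x * snd y = fst y * snd x" and e2: "fst y * snd z = fst z * snd y"
      by (auto simp: tfrac_rel_def)
    have "snd y * (fst x * snd z) = (fst x * snd y) * snd z" by (simp add: ac_simps)
    also have "\<dots> = snd x * (fst y * snd z)" by (simp only: e1) (simp add: ac_simps)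
    also have "\<dots> = snd y * (fst z * snd x)" by (simp only: e2) (simp add: ac_simps)
    finally have "fst x * snd z = fst z * snd x" by (rule nonzerodiv_cancel[OF nz(2)])
    then show "tfrac_rel x z" using nz by (simp add: tfrac_rel_def)
  qed
qed

quotient_type (overloaded) 'a tfrac = "'a::comm_ring_1 \<times> 'a" / partial: tfrac_rel
  by (rule part_equivp_tfrac_rel)

text \<open>\<open>tfrac a b\<close> is the fraction $a/b$ for a non-zero-divisor \<open>b\<close>, with the dummy value 0 otherwise.\<close>

lift_definition tfrac :: "'a::comm_ring_1 \<Rightarrow> 'a \<Rightarrow> 'a tfrac"
  is "\<lambda>a b. if nonzerodiv b then (a, b) else (0, 1)"
  by (simp add: tfrac_rel_def)

instantiation tfrac :: (comm_ring_1) comm_ring_1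
begin

lift_definition zero_tfrac :: "'a tfrac" is "(0, 1)" by (simp add: tfrac_rel_def)

lift_definition one_tfrac :: "'a tfrac" is "(1, 1)" by (simp add: tfrac_rel_def)

lift_definition plus_tfrac :: "'a tfrac \<Rightarrow> 'a tfrac \<Rightarrow> 'a tfrac"
  is "\<lambda>x y. (fst x * snd y + fst y * snd x, snd x * snd y)"
proof -
  fix x x' y y' :: "'a \<times> 'a"
  assume "tfrac_rel x x'" "tfrac_rel y y'"
  then have nz: "nonzerodiv (snd x)" "nonzerodiv (snd x')" "nonzerodiv (snd y)" "nonzerodiv (snd y')"
    and e1: "fst x * snd x' = fst x' * snd x" and e2: "fst y * snd y' = fst y' * snd y"
    by (auto simp: tfrac_rel_def)
  have "(fst x * snd y + fst y * snd x) * (snd x' * snd y')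
      = (fst x * snd x') * (snd y * snd y') + (fst y * snd y') * (snd x * snd x')"
    by (simp add: algebra_simps)
  also have "\<dots> = (fst x' * snd y' + fst y' * snd x') * (snd x * snd y)"
    by (simp only: e1 e2) (simp add: algebra_simps)
  finally show "tfrac_rel (fst x * snd y + fst y * snd x, snd x * snd y)
                  (fst x' * snd y' + fst y' * snd x', snd x' * snd y')"
    unfolding tfrac_rel_def fst_conv snd_conv by (intro conjI nonzerodiv_mult nz)
qed

lift_definition uminus_tfrac :: "'a tfrac \<Rightarrow> 'a tfrac" is "\<lambda>x. (- fst x, snd x)"
  by (simp add: tfrac_rel_def)

definition minus_tfrac :: "'a tfrac \<Rightarrow> 'a tfrac \<Rightarrow> 'a tfrac" where
  "minus_tfrac x y = x + - y"

lift_definition times_tfrac :: "'a tfrac \<Rightarrow> 'a tfrac \<Rightarrow> 'a tfrac"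
  is "\<lambda>x y. (fst x * fst y, snd x * snd y)"
proof -
  fix x x' y y' :: "'a \<times> 'a"
  assume "tfrac_rel x x'" "tfrac_rel y y'"
  then have nz: "nonzerodiv (snd x)" "nonzerodiv (snd x')" "nonzerodiv (snd y)" "nonzerodiv (snd y')"
    and e1: "fst x * snd x' = fst x' * snd x" and e2: "fst y * snd y' = fst y' * snd y"
    by (auto simp: tfrac_rel_def)
  have "(fst x * fst y) * (snd x' * snd y') = (fst x * snd x') * (fst y * snd y')"
    by (simp add: ac_simps)
  also have "\<dots> = (fst x' * snd x) * (fst y' * snd y)"
    by (simp only: e1 e2)
  also have "\<dots> = (fst x' * fst y') * (snd x * snd y)"
    by (simp add: ac_simps)
  finally show "tfrac_rel (fst x * fst y, snd x * snd y) (fst x' * fst y', snd x' * snd y')"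
    unfolding tfrac_rel_def fst_conv snd_conv by (intro conjI nonzerodiv_mult nz)
qed

instance
proof
  fix a b c :: "'a tfrac"
  show "a * b * c = a * (b * c)"
    by transfer (simp add: tfrac_rel_def nonzerodiv_mult ac_simps)
  show "a * b = b * a"
    by transfer (simp add: tfrac_rel_def nonzerodiv_mult ac_simps)
  show "1 * a = a"
    by transfer (simp add: tfrac_rel_def nonzerodiv_mult ac_simps)
  show "(a + b) * c = a * c + b * c"
    by transfer (simp add: tfrac_rel_def nonzerodiv_mult algebra_simps)
  show "a + b + c = a + (b + c)"
    by transfer (simp add: tfrac_rel_def nonzerodiv_mult algebra_simps)
  show "a + b = b + a"
    by transfer (simp add: tfrac_rel_def nonzerodiv_mult algebra_simps)
  show "0 + a = a"
    by transfer (simp add: tfrac_rel_def nonzerodiv_mult algebra_simps)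
  show "- a + a = 0"
    by transfer (simp add: tfrac_rel_def nonzerodiv_mult algebra_simps)
  show "a - b = a + - b"
    by (rule minus_tfrac_def)
  show "(0 :: 'a tfrac) \<noteq> 1"
    by transfer (simp add: tfrac_rel_def)
qed

end

definition to_tfrac :: "'a::comm_ring_1 \<Rightarrow> 'a tfrac" where
  "to_tfrac a = tfrac a 1"

lemma to_tfrac_inj: "to_tfrac a = to_tfrac b \<longleftrightarrow> a = b"
  unfolding to_tfrac_def by transfer (simp add: tfrac_rel_def)

lemma tfrac_mult_denom:
  "nonzerodiv b \<Longrightarrow> tfrac a b * to_tfrac b = to_tfrac a"
  unfolding to_tfrac_def by transfer (auto simp: tfrac_rel_def)

lemma tfrac_eq_to_tfrac_iff:
  "nonzerodiv b \<Longrightarrow> tfrac a b = to_tfrac c \<longleftrightarrow> a = c * b"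
  unfolding to_tfrac_def by transfer (simp add: tfrac_rel_def)


section \<open>Generalized n-series and s-binomial coefficients\<close>

definition gns :: "(nat \<Rightarrow> 'a::comm_ring_1) \<Rightarrow> bool" where
  "gns s \<longleftrightarrow>
     s 0 = 0 \<and>
     (\<forall>n>0. nonzerodiv (s n)) \<and>
     (\<forall>n k. n > k \<and> k > 0 \<longrightarrow> s (n - k) dvd s n - s k)"

text \<open>$R[1/s]$, the subring of the total ring of fractions obtained by adjoining to $R$ the
  inverses of the \<open>s n\<close> for \<open>n > 0\<close>. (Negatives come from multiplying by \<open>to_tfrac (- 1)\<close>.)\<close>

inductive_set loc :: "(nat \<Rightarrow> 'a::comm_ring_1) \<Rightarrow> 'a tfrac set" for s where
  base: "to_tfrac a \<in> loc s"
| inv: "n > 0 \<Longrightarrow> tfrac 1 (s n) \<in> loc s"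
| add: "x \<in> loc s \<Longrightarrow> y \<in> loc s \<Longrightarrow> x + y \<in> loc s"
| mult: "x \<in> loc s \<Longrightarrow> y \<in> loc s \<Longrightarrow> x * y \<in> loc s"

definition s_fact :: "(nat \<Rightarrow> 'a::comm_ring_1) \<Rightarrow> nat \<Rightarrow> 'a" where
  "s_fact s n = (\<Prod>i=1..n. s i)"

text \<open>For a generalized n-series the two fractions below lie in $R$; \<open>s_binom\<close> and \<open>s_quot\<close>
  are the corresponding elements of $R$. The value of \<open>s_quot s n k\<close> is meaningful
  for \<open>n > k\<close> only.\<close>

definition s_binom :: "(nat \<Rightarrow> 'a::comm_ring_1) \<Rightarrow> nat \<Rightarrow> nat \<Rightarrow> 'a" where
  "s_binom s n k =
     (if k \<le> n then THE b. to_tfrac b = tfrac (s_fact s n) (s_fact s k * s_fact s (n - k)) else 0)"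

definition s_quot :: "(nat \<Rightarrow> 'a::comm_ring_1) \<Rightarrow> nat \<Rightarrow> nat \<Rightarrow> 'a" where
  "s_quot s n k = (THE c. to_tfrac c = tfrac (s n - s k) (s (n - k)))"


section \<open>The s-derivative and the s-powers of x + y\<close>

text \<open>A polynomial in $x$ and $y$ is represented as a polynomial in $x$ whose coefficients are
  polynomials in $y$.\<close>

type_synonym 'a poly2 = "'a poly poly"

definition const2 :: "'a::comm_ring_1 \<Rightarrow> 'a poly2" where
  "const2 c = [:[:c:]:]"

definition varx :: "'a::comm_ring_1 poly2" where
  "varx = [:0, 1:]"

definition vary :: "'a::comm_ring_1 poly2" where
  "vary = [:[:0, 1:]:]"

definition poly2_over :: "'a::comm_ring_1 set \<Rightarrow> 'a poly2 set" where
  "poly2_over A = {f. \<forall>i j. coeff (coeff f i) j \<in> A}"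

text \<open>The coefficient of $x^n$ is an element of the scalar ring in $y$, so the linear map given by
  $x^n \mapsto s(n) x^{n-1}$ is the following sum; the term for \<open>n = 0\<close> vanishes.\<close>

definition nabla :: "(nat \<Rightarrow> 'a::comm_ring_1) \<Rightarrow> 'a tfrac poly2 \<Rightarrow> 'a tfrac poly2" where
  "nabla s f = (\<Sum>n=1..degree f. monom (smult (to_tfrac (s n)) (coeff f n)) (n - 1))"

text \<open>The substitution \<open>y = - x\<close>, giving a polynomial in $x$: the coefficients $c(y)$ become
  $c(-x)$, and the outer variable becomes $x$.\<close>

definition subst_y_neg_x :: "'a::comm_ring_1 poly2 \<Rightarrow> 'a poly" where
  "subst_y_neg_x f = poly (map_poly (\<lambda>c. pcompose c [:0, - 1:]) f) [:0, 1:]"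

definition eval2 :: "'a::comm_ring_1 poly2 \<Rightarrow> 'a \<Rightarrow> 'a \<Rightarrow> 'a" where
  "eval2 f x y = poly (poly f [:x:]) y"

definition is_s_powers ::
    "(nat \<Rightarrow> 'a::comm_ring_1) \<Rightarrow> (nat \<Rightarrow> 'a tfrac poly2) \<Rightarrow> bool" where
  "is_s_powers s P \<longleftrightarrow>
     (\<forall>n. P n \<in> poly2_over (loc s)) \<and>
     P 0 = 1 \<and>
     (\<forall>n>0. subst_y_neg_x (P n) = 0) \<and>
     (\<forall>n>0. nabla s (P n) = const2 (to_tfrac (s n)) * P (n - 1))"

text \<open>\<open>s_power s n\<close> is $(x+y)^n_s$; \<open>s_power01 s k\<close> is $(0+1)^k_s$.\<close>

definition s_power :: "(nat \<Rightarrow> 'a::comm_ring_1) \<Rightarrow> nat \<Rightarrow> 'a tfrac poly2" where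
  "s_power s = (THE P. is_s_powers s P)"

definition s_power01 :: "(nat \<Rightarrow> 'a::comm_ring_1) \<Rightarrow> nat \<Rightarrow> 'a tfrac" where
  "s_power01 s k = eval2 (s_power s k) 0 1"


section \<open>The Vandermonde weights\<close>

text \<open>The sequences $i_1 < \dots < i_j$ are functions on \<open>{1..j}\<close> (extensional, so that
  each sequence occurs exactly once). The definition is intended for \<open>j \<le> k\<close>, \<open>k - j \<le> m\<close>; then the
  inner natural-number subtraction does not truncate.\<close>

definition s_vander :: "(nat \<Rightarrow> 'a::comm_ring_1) \<Rightarrow> nat \<Rightarrow> nat \<Rightarrow> nat \<Rightarrow> nat \<Rightarrow> 'a" where
  "s_vander s n j m k =
     (\<Sum>i \<in> {i \<in> {1..j} \<rightarrow>\<^sub>E {m<..m+n}. strict_mono_on {1..j} i}.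
        \<Prod>l=1..j. s_quot s (i l) (i l - (k - j + l)))"

end

theory Submission
  imports Defs
begin

text \<open>Write \<open>n!\<close> and \<open>B(n,k)\<close> for the factorials and binomial coefficients of \<open>s\<close> and \<open>c(n,k)\<close>
  for the quotient \<open>(s(n) - s(k)) / s(n-k)\<close>. The defining property of a generalized n-series says
  that \<open>s(n) = s(k) + c(n,k) s(n-k)\<close>. Multiplied by \<open>(n-1)!\<close> this is Pascal's identity after clearing
  denominators; it yields first, by induction, that the binomial coefficients lie in \<open>R\<close>
  (\<open>s_fact_mult_dvd\<close>), and then the identity itself (\<open>s_pascal\<close>). Combined with the symmetry
  \<open>B(n,k) = B(n,n-k)\<close> it gives a dual form, \<open>s_pascal_dual\<close>.

  The Vandermonde identity is the dual Pascal identity applied \<open>n\<close> times to \<open>B(m+n,k)\<close>: at each level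
  \<open>i\<close> from \<open>m+n\<close> down to \<open>m+1\<close> one either keeps the lower index or lowers it by one at the cost of a
  factor \<open>c\<close>, and the chosen levels are the sequences over which the weights sum. Accordingly the
  weights satisfy the matching recursion (\<open>s_vander_Suc_Suc\<close>), obtained by splitting the sequences
  by whether they use the top level.

  For the binomial theorem, \<open>\<nabla>\<close> kills only the constants in \<open>x\<close>, and the substitution \<open>y = -x\<close>
  is injective on those, so the conditions on the s-powers determine each power from its predecessor
  (\<open>is_s_powers_unique\<close>). On the other hand the sum \<open>\<Sum>k. B(n,k) a(k) x^(n-k) y^k\<close> has the correct
  s-derivative for every sequence \<open>a\<close> with \<open>a(0) = 1\<close>, because \<open>B(n,k) s(n-k) = s(n) B(n-1,k)\<close>; and
  the vanishing at \<open>y = -x\<close> is a triangular recursion that determines \<open>a\<close> inside \<open>R\<close>. Hence these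
  sums are the s-powers, and evaluation at \<open>(0,1)\<close> identifies \<open>a(k)\<close> as \<open>(0+1)^k\<close>.

  For the Lucas theorem everything is read modulo \<open>s(p)\<close>. Then \<open>s\<close> is periodic with period \<open>p\<close>
  (\<open>cong_s_add_mult\<close>), and the extra hypothesis lets the Euclidean algorithm run on the values of
  \<open>s\<close> (\<open>s_bezout\<close>), so that \<open>s(a)\<close> is invertible whenever \<open>p\<close> does not divide \<open>a\<close>. Therefore
  \<open>c(n,k)\<close> depends only on the residues of \<open>n\<close> and \<open>k\<close> when these differ, and the right-hand side of
  the Lucas congruence satisfies the same Pascal recursion as the left-hand side. Only the step from
  the residue \<open>p - 1\<close> to a multiple of \<open>p\<close> is different (\<open>lucas_row_carry\<close>): there the ordinary Pascal
  identity appears in the columns divisible by \<open>p\<close>, and the other columns vanish because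
  \<open>B(p,k) \<equiv> 0\<close> for \<open>0 < k < p\<close>.\<close>

section \<open>Factorials, quotients and binomial coefficients of a GNS\<close>

lemma s_fact_0 [simp]: "s_fact s 0 = 1"
  by (simp add: s_fact_def)

lemma s_fact_Suc: "s_fact s (Suc n) = s_fact s n * s (Suc n)"
  by (simp add: s_fact_def)

lemma s_binom_eq_0: "n < k \<Longrightarrow> s_binom s n k = 0"
  by (simp add: s_binom_def)

context
  fixes s :: "nat \<Rightarrow> 'a::comm_ring_1"
  assumes gns: "gns s"
begin

lemma gns_0 [simp]: "s 0 = 0"
  using gns by (simp add: gns_def)

lemma gns_nonzerodiv: "n > 0 \<Longrightarrow> nonzerodiv (s n)"
  using gns by (simp add: gns_def)

lemma gns_dvd_diff: "k < n \<Longrightarrow> s (n - k) dvd s n - s k"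
  using gns by (cases "k = 0") (auto simp: gns_def)

lemma nonzerodiv_s_fact: "nonzerodiv (s_fact s n)"
  by (induction n) (simp_all add: s_fact_Suc nonzerodiv_mult gns_nonzerodiv)

lemma s_quot_mult:
  assumes "k < n"
  shows "s_quot s n k * s (n - k) = s n - s k"
proof -
  have nz: "nonzerodiv (s (n - k))" using assms by (simp add: gns_nonzerodiv)
  obtain c where c: "s n - s k = s (n - k) * c"
    using gns_dvd_diff[OF assms] by (rule dvdE)
  have "tfrac (s n - s k) (s (n - k)) = to_tfrac c"
    using c by (simp add: tfrac_eq_to_tfrac_iff[OF nz] mult.commute)
  then have "s_quot s n k = c" by (simp add: s_quot_def to_tfrac_inj)
  with c show ?thesis by (simp add: mult.commute)
qed

lemma s_quot_0: "0 < n \<Longrightarrow> s_quot s n 0 = 1"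
  using s_quot_mult[of 0 n] nonzerodiv_cancel[OF gns_nonzerodiv, of n "s_quot s n 0" 1]
  by (simp add: mult.commute)

text \<open>Integrality of the binomial coefficients. Splitting \<open>s (a + b) = s a + c * s b\<close> writes the
  factorial of \<open>a + b\<close> as a combination of two terms that are divisible by induction: in each, the
  missing last factor of one of the two factorials is supplied by \<open>s a\<close> or \<open>s b\<close>.\<close>

lemma s_fact_mult_dvd: "s_fact s a * s_fact s b dvd s_fact s (a + b)"
proof (induction "a + b" arbitrary: a b)
  case 0
  then show ?case by simp
next
  case (Suc n)
  show ?case
  proof (cases "a = 0 \<or> b = 0")
    case True
    then show ?thesis by auto
  next
    case False
    then obtain a' b' where ab: "a = Suc a'" "b = Suc b'" by (metis not0_implies_Suc)
    have n: "n = a' + Suc b'" "n = Suc a' + b'" using Suc(2) ab by auto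
    obtain u where u: "s_fact s n = s_fact s a' * s_fact s (Suc b') * u"
      using Suc(1)[OF n(1)] n(1) by auto
    obtain v where v: "s_fact s n = s_fact s (Suc a') * s_fact s b' * v"
      using Suc(1)[OF n(2)] n(2) by auto
    have q: "s (Suc n) = s a + s_quot s (Suc n) a * s b"
      using s_quot_mult[of a "Suc n"] Suc(2) ab by (simp add: algebra_simps)
    have "s_fact s (a + b) = s_fact s n * s a + s_quot s (Suc n) a * (s_fact s n * s b)"
      using Suc(2) by (metis (no_types, lifting) q s_fact_Suc distrib_left mult.commute mult.left_commute)
    also have "s_fact s n * s a = s_fact s a * s_fact s b * u"
      by (simp add: u ab s_fact_Suc ac_simps)
    also have "s_fact s n * s b = s_fact s a * s_fact s b * v"
      by (simp add: v ab s_fact_Suc ac_simps)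
    finally show ?thesis by simp
  qed
qed

lemma s_binom_fact:
  assumes "k \<le> n"
  shows "s_binom s n k * (s_fact s k * s_fact s (n - k)) = s_fact s n"
proof -
  let ?d = "s_fact s k * s_fact s (n - k)"
  have nz: "nonzerodiv ?d" by (intro nonzerodiv_mult nonzerodiv_s_fact)
  obtain b where b: "s_fact s n = b * ?d"
    using s_fact_mult_dvd[of k "n - k"] assms by (auto simp: mult.commute)
  have "tfrac (s_fact s n) ?d = to_tfrac b"
    using b by (simp add: tfrac_eq_to_tfrac_iff[OF nz])
  then have "s_binom s n k = b" using assms by (simp add: s_binom_def to_tfrac_inj)
  with b show ?thesis by simp
qed

lemma s_binom_eqI:
  assumes "k \<le> n" "b * (s_fact s k * s_fact s (n - k)) = s_fact s n"
  shows "s_binom s n k = b"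
proof (rule nonzerodiv_cancel)
  show "nonzerodiv (s_fact s k * s_fact s (n - k))"
    by (intro nonzerodiv_mult nonzerodiv_s_fact)
  show "s_fact s k * s_fact s (n - k) * s_binom s n k = s_fact s k * s_fact s (n - k) * b"
    using assms s_binom_fact[OF assms(1)] by (simp add: mult.commute)
qed

lemma s_binom_0 [simp]: "s_binom s n 0 = 1"
  by (rule s_binom_eqI) auto

lemma s_binom_self [simp]: "s_binom s n n = 1"
  by (rule s_binom_eqI) auto

lemma s_binom_symmetric: "k \<le> n \<Longrightarrow> s_binom s n (n - k) = s_binom s n k"
  by (rule s_binom_eqI) (use s_binom_fact[of k n] in \<open>auto simp: mult.commute\<close>)

text \<open>Both neighbouring coefficients are brought to the common denominator
  \<open>s_fact s (Suc k) * s_fact s (n - k)\<close>, after which the identity is that of \<open>s_quot_mult\<close>. With the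
  value 0 for \<open>k > n\<close> it holds for all \<open>n\<close> and \<open>k\<close>, which spares later inductions the boundary
  cases.\<close>

lemma s_pascal:
  "s_binom s (Suc n) (Suc k) = s_binom s n k + s_quot s (Suc n) (Suc k) * s_binom s n (Suc k)"
proof (cases "k < n")
  case True
  then have diff: "n - k = Suc (n - Suc k)" by simp
  let ?c = "s_quot s (Suc n) (Suc k)" and ?d = "s_fact s (Suc k) * s_fact s (n - k)"
  have "s_binom s n k * ?d = s (Suc k) * (s_binom s n k * (s_fact s k * s_fact s (n - k)))"
    by (simp add: s_fact_Suc ac_simps)
  also have "\<dots> = s (Suc k) * s_fact s n"
    using True by (simp add: s_binom_fact)
  finally have 1: "s_binom s n k * ?d = s (Suc k) * s_fact s n" .
  have "s_binom s n (Suc k) * ?d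
      = s (n - k) * (s_binom s n (Suc k) * (s_fact s (Suc k) * s_fact s (n - Suc k)))"
    by (simp add: diff s_fact_Suc ac_simps)
  also have "\<dots> = s (n - k) * s_fact s n"
    using True by (simp only: s_binom_fact Suc_leI)
  finally have 2: "s_binom s n (Suc k) * ?d = s (n - k) * s_fact s n" .
  have "(s_binom s n k + ?c * s_binom s n (Suc k)) * ?d
      = (s (Suc k) + ?c * s (n - k)) * s_fact s n"
    unfolding distrib_right mult.assoc[of ?c] 1 2 ..
  also have "\<dots> = s_fact s (Suc n)"
    using s_quot_mult[of "Suc k" "Suc n"] True by (simp add: s_fact_Suc mult.commute)
  finally show ?thesis
    by (intro s_binom_eqI) (use True in auto)
qed (cases "k = n"; simp add: s_binom_eq_0)

text \<open>Pascal's identity reflected by the symmetry \<open>k \<mapsto> n - k\<close>; here the lower index stays fixed in the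
  term without a coefficient, which is the form that the Vandermonde weights iterate.\<close>

lemma s_pascal_dual:
  "s_binom s (Suc n) (Suc k) = s_binom s n (Suc k) + s_quot s (Suc n) (n - k) * s_binom s n k"
proof (cases "k < n")
  case True
  then have diff: "n - k = Suc (n - Suc k)" by simp
  have "s_binom s (Suc n) (Suc k) = s_binom s (Suc n) (n - k)"
    using True s_binom_symmetric[of "Suc k" "Suc n"] by simp
  also have "\<dots> = s_binom s n (n - Suc k) + s_quot s (Suc n) (n - k) * s_binom s n (n - k)"
    unfolding diff by (rule s_pascal)
  finally show ?thesis
    using True by (simp add: s_binom_symmetric)
qed (cases "k = n"; simp add: s_binom_eq_0 s_quot_0)

lemma s_binom_absorb:
  "s_binom s (Suc n) (Suc k) * s (Suc k) = s (Suc n) * s_binom s n k"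
proof (cases "k \<le> n")
  case True
  show ?thesis
  proof (rule nonzerodiv_cancel)
    show "nonzerodiv (s_fact s k * s_fact s (n - k))"
      by (intro nonzerodiv_mult nonzerodiv_s_fact)
    have "s_fact s k * s_fact s (n - k) * (s_binom s (Suc n) (Suc k) * s (Suc k))
        = s_binom s (Suc n) (Suc k) * (s_fact s (Suc k) * s_fact s (Suc n - Suc k))"
      by (simp add: s_fact_Suc ac_simps)
    also have "\<dots> = s (Suc n) * (s_binom s n k * (s_fact s k * s_fact s (n - k)))"
      using True by (simp only: s_binom_fact Suc_le_mono s_fact_Suc[of s n] mult.commute)
    finally show "s_fact s k * s_fact s (n - k) * (s_binom s (Suc n) (Suc k) * s (Suc k))
        = s_fact s k * s_fact s (n - k) * (s (Suc n) * s_binom s n k)"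
      by (simp add: ac_simps)
  qed
qed (simp add: s_binom_eq_0)

lemma s_binom_absorb_comp:
  assumes "k \<le> n"
  shows "s_binom s (Suc n) k * s (Suc n - k) = s (Suc n) * s_binom s n k"
proof -
  have "s_binom s (Suc n) k = s_binom s (Suc n) (Suc (n - k))"
    using assms s_binom_symmetric[of k "Suc n"] by (simp add: Suc_diff_le)
  then show ?thesis
    using s_binom_absorb[of n "n - k"] assms by (simp add: Suc_diff_le s_binom_symmetric)
qed

end


section \<open>The Vandermonde identity\<close>

abbreviation strict_seqs :: "nat \<Rightarrow> nat \<Rightarrow> nat \<Rightarrow> (nat \<Rightarrow> nat) set" where
  "strict_seqs j m n \<equiv> {i \<in> {1..j} \<rightarrow>\<^sub>E {m<..m+n}. strict_mono_on {1..j} i}"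

lemma finite_strict_seqs: "finite (strict_seqs j m n)"
  by (rule finite_subset[of _ "{1..j} \<rightarrow>\<^sub>E {m<..m+n}"]) (auto intro: finite_PiE)

text \<open>Sequences that may use the additional top value \<open>m + n + 1\<close> either avoid it or have it as last
  entry; in the second case the rest is an arbitrary shorter sequence without it.\<close>

lemma strict_seqs_Suc:
  "strict_seqs (Suc j) m (Suc n) =
     strict_seqs (Suc j) m n \<union> (\<lambda>i. i(Suc j := Suc (m + n))) ` strict_seqs j m n"
  (is "?L = ?A \<union> ?f ` ?B")
proof (intro equalityI subsetI)
  fix i assume i: "i \<in> ?L"
  then have iP: "i \<in> {1..Suc j} \<rightarrow>\<^sub>E {m<..m + Suc n}" and mono: "strict_mono_on {1..Suc j} i"
    by auto
  have last: "i (Suc j) \<le> Suc (m + n)" using PiE_mem[OF iP, of "Suc j"] by auto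
  have less: "i l < i (Suc j)" if "l \<in> {1..j}" for l
    using strict_mono_onD[OF mono] that by auto
  have range: "m < i l" if "l \<in> {1..Suc j}" for l
    using PiE_mem[OF iP that] by auto
  show "i \<in> ?A \<union> ?f ` ?B"
  proof (cases "i (Suc j) = Suc (m + n)")
    case True
    let ?i = "i(Suc j := undefined)"
    have "?i \<in> ?B"
    proof (intro CollectI conjI PiE_I)
      fix l assume l: "l \<in> {1..j}"
      then show "?i l \<in> {m<..m + n}" using less[OF l] range[of l] True by auto
    next
      fix l assume "l \<notin> {1..j}"
      then show "?i l = undefined" using PiE_arb[OF iP, of l] by auto
    next
      show "strict_mono_on {1..j} ?i"
        using mono by (auto simp: strict_mono_on_def)
    qed
    moreover have "i = ?f ?i" using True by auto
    ultimately show ?thesis by blast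
  next
    case False
    have "i \<in> ?A"
    proof (intro CollectI conjI PiE_I)
      fix l assume l: "l \<in> {1..Suc j}"
      then have "i l \<le> i (Suc j)" using less[of l] by (cases "l = Suc j") auto
      then show "i l \<in> {m<..m + n}" using range[OF l] last False by auto
    qed (use mono PiE_arb[OF iP] in auto)
    then show ?thesis by blast
  qed
next
  fix i assume "i \<in> ?A \<union> ?f ` ?B"
  then show "i \<in> ?L"
  proof
    assume "i \<in> ?A"
    then show ?thesis by (auto simp: PiE_iff)
  next
    assume "i \<in> ?f ` ?B"
    then obtain h where h: "h \<in> ?B" "i = ?f h" by blast
    then have hP: "h \<in> {1..j} \<rightarrow>\<^sub>E {m<..m + n}" and mono: "strict_mono_on {1..j} h" by auto
    show ?thesis
    proof (intro CollectI conjI PiE_I)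
      fix l assume "l \<in> {1..Suc j}"
      then show "i l \<in> {m<..m + Suc n}"
        using PiE_mem[OF hP, of l] h(2) by (cases "l = Suc j") auto
    next
      fix l assume "l \<notin> {1..Suc j}"
      then show "i l = undefined" using PiE_arb[OF hP, of l] h(2) by auto
    next
      show "strict_mono_on {1..Suc j} i"
      proof (rule strict_mono_onI)
        fix l l' assume l: "l \<in> {1..Suc j}" "l' \<in> {1..Suc j}" "l < l'"
        have "h l < Suc (m + n)" using PiE_mem[OF hP, of l] l by auto
        then show "i l < i l'"
          using l h(2) strict_mono_onD[OF mono, of l l'] by (cases "l' = Suc j") auto
      qed
    qed
  qed
qed

lemma s_vander_0: "s_vander s n 0 m k = 1"
proof -
  have "strict_seqs 0 m n = {\<lambda>_. undefined}" by (auto simp: strict_mono_on_def)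
  then show ?thesis by (simp add: s_vander_def)
qed

lemma s_vander_0_Suc: "s_vander s 0 (Suc j) m k = 0"
proof -
  have "strict_seqs (Suc j) m 0 = {}" by (auto simp: PiE_def Pi_def)
  then show ?thesis by (simp only: s_vander_def sum.empty)
qed

text \<open>For sequences ending in the top value, the last factor of the weight is the coefficient of
  \<open>s_pascal_dual\<close>, and the remaining factors are unchanged since they depend on \<open>j\<close> and \<open>k\<close> only
  through \<open>k - j\<close>.\<close>

lemma s_vander_Suc_Suc:
  assumes "j \<le> k"
  shows "s_vander s (Suc n) (Suc j) m (Suc k) =
    s_vander s n (Suc j) m (Suc k) + s_quot s (Suc (m + n)) (m + n - k) * s_vander s n j m k"
proof -
  let ?f = "\<lambda>i :: nat \<Rightarrow> nat. i(Suc j := Suc (m + n))"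
  let ?w = "\<lambda>i. \<Prod>l=1..Suc j. s_quot s (i l) (i l - (Suc k - Suc j + l))"
  have disj: "strict_seqs (Suc j) m n \<inter> ?f ` strict_seqs j m n = {}"
    by (auto simp: PiE_def Pi_def)
  have inj: "inj_on ?f (strict_seqs j m n)"
  proof (rule inj_onI)
    fix h h' assume h: "h \<in> strict_seqs j m n" "h' \<in> strict_seqs j m n" "?f h = ?f h'"
    have "h (Suc j) = undefined" "h' (Suc j) = undefined" using h(1,2) by (auto simp: PiE_def extensional_def)
    with h(3) show "h = h'" by (metis fun_upd_triv fun_upd_upd)
  qed
  have w: "?w (?f h) = s_quot s (Suc (m + n)) (m + n - k)
      * (\<Prod>l=1..j. s_quot s (h l) (h l - (k - j + l)))" for h
  proof -
    have "(\<Prod>l=1..j. s_quot s (?f h l) (?f h l - (k - j + l)))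
        = (\<Prod>l=1..j. s_quot s (h l) (h l - (k - j + l)))"
      by (rule prod.cong) auto
    then show ?thesis using assms by (simp add: mult.commute)
  qed
  have "s_vander s (Suc n) (Suc j) m (Suc k) = sum ?w (strict_seqs (Suc j) m (Suc n))"
    by (simp add: s_vander_def)
  also have "\<dots> = sum ?w (strict_seqs (Suc j) m n) + sum ?w (?f ` strict_seqs j m n)"
    unfolding strict_seqs_Suc
    by (rule sum.union_disjoint) (use disj finite_strict_seqs in auto)
  also have "sum ?w (?f ` strict_seqs j m n) = (\<Sum>h\<in>strict_seqs j m n. ?w (?f h))"
    by (simp only: sum.reindex[OF inj] o_def)
  also have "\<dots> = s_quot s (Suc (m + n)) (m + n - k) * s_vander s n j m k"
    unfolding w s_vander_def by (simp only: sum_distrib_left)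
  also have "sum ?w (strict_seqs (Suc j) m n) = s_vander s n (Suc j) m (Suc k)"
    by (simp only: s_vander_def)
  finally show ?thesis .
qed

lemma s_vander_eq_0: "n < j \<Longrightarrow> j \<le> k \<Longrightarrow> s_vander s n j m k = 0"
proof (induction n arbitrary: j k)
  case 0
  then show ?case by (cases j) (auto simp: s_vander_0_Suc)
next
  case (Suc n)
  then obtain j' k' where "j = Suc j'" "k = Suc k'" by (metis Suc_lessE Suc_le_D)
  with Suc show ?case by (simp add: s_vander_Suc_Suc)
qed

text \<open>Here \<open>j\<close> runs over all of \<open>{..k}\<close>: the additional terms vanish, and the range no longer depends
  on \<open>m\<close> and \<open>n\<close>, which makes the induction a plain application of the two recursions.\<close>

lemma s_vandermonde_all:
  assumes "gns s"
  shows "s_binom s (m + n) k = (\<Sum>j\<le>k. s_binom s m (k - j) * s_vander s n j m k)"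
proof (induction n arbitrary: k)
  case 0
  have "(\<Sum>j\<le>k. s_binom s m (k - j) * s_vander s 0 j m k)
      = (\<Sum>j\<le>k. if j = 0 then s_binom s m k else 0)"
    by (intro sum.cong refl) (auto simp: s_vander_0 s_vander_0_Suc gr0_conv_Suc)
  then show ?case by simp
next
  case (Suc n)
  show ?case
  proof (cases k)
    case 0
    then show ?thesis using assms by (simp add: s_vander_0)
  next
    case (Suc k')
    let ?c = "s_quot s (Suc (m + n)) (m + n - k')"
    have "(\<Sum>j\<le>k. s_binom s m (k - j) * s_vander s (Suc n) j m k)
        = s_binom s m k + (\<Sum>j\<le>k'. s_binom s m (k' - j) * s_vander s (Suc n) (Suc j) m (Suc k'))"
      by (simp add: Suc sum.atMost_Suc_shift s_vander_0 del: sum.atMost_Suc)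
    also have "(\<Sum>j\<le>k'. s_binom s m (k' - j) * s_vander s (Suc n) (Suc j) m (Suc k'))
        = (\<Sum>j\<le>k'. s_binom s m (k' - j) * s_vander s n (Suc j) m (Suc k')
              + ?c * (s_binom s m (k' - j) * s_vander s n j m k'))"
      by (intro sum.cong refl) (simp add: s_vander_Suc_Suc algebra_simps)
    also have "\<dots> = (\<Sum>j\<le>k'. s_binom s m (k' - j) * s_vander s n (Suc j) m (Suc k'))
        + ?c * s_binom s (m + n) k'"
      by (simp add: sum.distrib sum_distrib_left Suc.IH)
    also have "s_binom s m k + \<dots> = s_binom s (m + n) (Suc k') + ?c * s_binom s (m + n) k'"
      by (simp add: Suc.IH[of "Suc k'"] Suc sum.atMost_Suc_shift s_vander_0 del: sum.atMost_Suc)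
    also have "\<dots> = s_binom s (m + Suc n) k"
      using s_pascal_dual[OF assms] by (simp add: Suc)
    finally show ?thesis by simp
  qed
qed

lemma s_vandermonde:
  assumes "gns s"
  shows "s_binom s (m + n) k =
    (\<Sum>j | j \<le> n \<and> j \<le> k \<and> k - j \<le> m. s_binom s m (k - j) * s_vander s n j m k)"
  unfolding s_vandermonde_all[OF assms]
proof (rule sum.mono_neutral_right)
  show "\<forall>j\<in>{..k} - {j. j \<le> n \<and> j \<le> k \<and> k - j \<le> m}. s_binom s m (k - j) * s_vander s n j m k = 0"
  proof
    fix j assume "j \<in> {..k} - {j. j \<le> n \<and> j \<le> k \<and> k - j \<le> m}"
    then have "n < j \<and> j \<le> k \<or> m < k - j" by auto
    then show "s_binom s m (k - j) * s_vander s n j m k = 0"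
      by (auto simp: s_binom_eq_0 s_vander_eq_0)
  qed
qed auto


section \<open>Existence and uniqueness of the s-powers\<close>

lemma to_tfrac_0 [simp]: "to_tfrac 0 = 0"
  unfolding to_tfrac_def by transfer (simp add: tfrac_rel_def)

lemma to_tfrac_1 [simp]: "to_tfrac 1 = 1"
  unfolding to_tfrac_def by transfer (simp add: tfrac_rel_def)

lemma to_tfrac_add: "to_tfrac (a + b) = to_tfrac a + to_tfrac b"
  unfolding to_tfrac_def by transfer (simp add: tfrac_rel_def)

lemma to_tfrac_mult: "to_tfrac (a * b) = to_tfrac a * to_tfrac b"
  unfolding to_tfrac_def by transfer (simp add: tfrac_rel_def)

lemma to_tfrac_minus: "to_tfrac (- a) = - to_tfrac a"
  unfolding to_tfrac_def by transfer (simp add: tfrac_rel_def)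

lemma to_tfrac_power: "to_tfrac (a ^ n) = to_tfrac a ^ n"
  by (induction n) (simp_all add: to_tfrac_mult)

lemma to_tfrac_sum: "to_tfrac (sum f A) = (\<Sum>x\<in>A. to_tfrac (f x))"
  by (induction A rule: infinite_finite_induct) (simp_all add: to_tfrac_add)

lemma to_tfrac_mult_eq_0:
  assumes "nonzerodiv b" "to_tfrac b * x = 0"
  shows "x = 0"
proof -
  have "x = tfrac 1 b * to_tfrac b * x" using tfrac_mult_denom[OF assms(1), of 1] by simp
  also have "\<dots> = 0" using assms(2) by (simp add: mult.assoc)
  finally show ?thesis .
qed

lemma coeff_nabla:
  "coeff (nabla s f) i = smult (to_tfrac (s (Suc i))) (coeff f (Suc i))"
proof -
  have "coeff (nabla s f) i
      = (\<Sum>n=1..degree f. if n = Suc i then smult (to_tfrac (s n)) (coeff f n) else 0)"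
    unfolding nabla_def coeff_sum by (intro sum.cong) auto
  then show ?thesis by (auto simp: coeff_eq_0)
qed

lemma subst_y_neg_x_add: "subst_y_neg_x (f + g) = subst_y_neg_x f + subst_y_neg_x g"
proof -
  have "map_poly (\<lambda>c. pcompose c [:0, - 1:]) (f + g)
     = map_poly (\<lambda>c. pcompose c [:0, - 1:]) f + map_poly (\<lambda>c. pcompose c [:0, - 1:]) g"
    by (rule poly_eqI) (simp add: coeff_map_poly pcompose_add)
  then show ?thesis by (simp add: subst_y_neg_x_def)
qed

lemma subst_y_neg_x_0 [simp]: "subst_y_neg_x 0 = 0"
  by (simp add: subst_y_neg_x_def)

lemma subst_y_neg_x_diff: "subst_y_neg_x (f - g) = subst_y_neg_x f - subst_y_neg_x g"
  using subst_y_neg_x_add[of "f - g" g] by simp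

lemma subst_y_neg_x_sum: "subst_y_neg_x (sum f A) = (\<Sum>a\<in>A. subst_y_neg_x (f a))"
  by (induction A rule: infinite_finite_induct) (simp_all add: subst_y_neg_x_add)

lemma pcompose_monom: "pcompose (monom c k) q = smult c (q ^ k)"
  by (induction k) (simp_all add: monom_0 monom_Suc pcompose_pCons)

lemma neg_x_power: "[:0, - 1 :: 'a::comm_ring_1:] ^ k = monom ((- 1) ^ k) k"
  by (induction k) (simp_all add: monom_0 monom_Suc one_pCons minus_monom)

lemma subst_y_neg_x_monom:
  fixes c :: "'a::comm_ring_1"
  shows "subst_y_neg_x (monom (monom c k) i) = monom ((- 1) ^ k * c) (k + i)"
proof -
  have "map_poly (\<lambda>c. pcompose c [:0, - 1:]) (monom (monom c k) i)
      = monom (monom ((- 1) ^ k * c) k) i"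
    by (rule poly_eqI) (simp add: coeff_map_poly pcompose_monom neg_x_power smult_monom mult.commute)
  moreover have "[:0, 1 :: 'a:] ^ i = monom 1 i" for i
    by (simp add: monom_altdef)
  ultimately show ?thesis
    by (simp add: subst_y_neg_x_def poly_monom mult_monom)
qed

text \<open>The difference \<open>D\<close> of two candidates for the next power is killed by \<open>nabla\<close>. Since the \<open>s i\<close> with
  \<open>i > 0\<close> are not zero-divisors, \<open>D\<close> has no positive powers of \<open>x\<close>; it is then a polynomial in \<open>y\<close>
  that vanishes after \<open>y = - x\<close>, hence zero.\<close>

lemma is_s_powers_unique:
  assumes gns: "gns s" and P: "is_s_powers s P" and Q: "is_s_powers s Q"
  shows "P n = Q n"
proof (induction n)
  case 0
  then show ?case using P Q by (simp add: is_s_powers_def)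
next
  case (Suc n)
  let ?D = "P (Suc n) - Q (Suc n)"
  have nabla_eq: "nabla s (P (Suc n)) = nabla s (Q (Suc n))"
    using P Q Suc by (simp add: is_s_powers_def)
  have coeffs: "smult (to_tfrac (s (Suc i))) (coeff ?D (Suc i)) = 0" for i
    using arg_cong[OF nabla_eq, of "\<lambda>f. coeff f i"] by (simp add: coeff_nabla smult_diff_right)
  have "coeff ?D (Suc i) = 0" for i
  proof (rule poly_eqI)
    fix j
    have "to_tfrac (s (Suc i)) * coeff (coeff ?D (Suc i)) j = 0"
      using arg_cong[OF coeffs[of i], of "\<lambda>f. coeff f j"] by simp
    then show "coeff (coeff ?D (Suc i)) j = coeff 0 j"
      unfolding coeff_0 by (rule to_tfrac_mult_eq_0[OF gns_nonzerodiv[OF gns zero_less_Suc]])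
  qed
  then have "coeff ?D i = coeff [:coeff ?D 0:] i" for i
    by (cases i) simp_all
  then have D: "?D = [:coeff ?D 0:]" by (rule poly_eqI)
  have "subst_y_neg_x ?D = 0"
    using P Q by (simp add: is_s_powers_def subst_y_neg_x_diff)
  then have "pcompose (coeff ?D 0) [:0, - 1:] = 0"
    by (subst (asm) D) (simp add: subst_y_neg_x_def map_poly_pCons)
  \<comment> \<open>The substitution is an involution, so it is injective.\<close>
  moreover have "c = pcompose (pcompose c [:0, - 1:]) [:0, - 1:]" for c :: "'a tfrac poly"
    by (simp add: pcompose_assoc[symmetric] pcompose_pCons)
  ultimately have "coeff ?D 0 = 0" by (metis pcompose_0)
  with D show ?case by simp
qed

text \<open>The numbers \<open>(- 1) ^ k\<close> times \<open>(0+1)^k\<close>, given by the recursion that expresses the vanishing of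
  the s-powers at \<open>y = - x\<close>. The sign is absorbed here so that the recursion has none.\<close>

fun signed_s_power01 :: "(nat \<Rightarrow> 'a::comm_ring_1) \<Rightarrow> nat \<Rightarrow> 'a" where
  "signed_s_power01 s 0 = 1"
| "signed_s_power01 s (Suc n) = - (\<Sum>k\<le>n. s_binom s (Suc n) k * signed_s_power01 s k)"

definition explicit_s_power :: "(nat \<Rightarrow> 'a::comm_ring_1) \<Rightarrow> nat \<Rightarrow> 'a tfrac poly2" where
  "explicit_s_power s n =
     (\<Sum>k\<le>n. monom (monom (to_tfrac (s_binom s n k * ((- 1) ^ k * signed_s_power01 s k))) k) (n - k))"

lemma coeff_explicit_s_power:
  "coeff (explicit_s_power s n) i =
     (if i \<le> n then monom (to_tfrac (s_binom s n (n - i) * ((- 1) ^ (n - i) * signed_s_power01 s (n - i)))) (n - i)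
      else 0)"
proof -
  let ?m = "\<lambda>k. monom (to_tfrac (s_binom s n k * ((- 1) ^ k * signed_s_power01 s k))) k"
  have "coeff (explicit_s_power s n) i = (\<Sum>k\<le>n. if n - k = i then ?m k else 0)"
    unfolding explicit_s_power_def coeff_sum by (intro sum.cong) auto
  also have "\<dots> = (\<Sum>k\<le>n. if k = n - i then (if i \<le> n then ?m k else 0) else 0)"
    by (intro sum.cong) auto
  finally show ?thesis by simp
qed

text \<open>The condition at \<open>y = - x\<close> is the recursion of \<open>signed_s_power01\<close>, and the condition on \<open>nabla\<close> is,
  coefficient by coefficient, the identity \<open>s_binom_absorb_comp\<close>.\<close>

lemma is_s_powers_explicit_s_power:
  assumes gns: "gns s"
  shows "is_s_powers s (explicit_s_power s)"
  unfolding is_s_powers_def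
proof (intro conjI allI impI)
  fix n
  have "(0 :: 'a tfrac) \<in> loc s" using loc.base[of 0 s] by simp
  then show "explicit_s_power s n \<in> poly2_over (loc s)"
    by (auto simp: poly2_over_def coeff_explicit_s_power intro: loc.base)
next
  show "explicit_s_power s 0 = 1"
    using gns by (simp add: explicit_s_power_def one_pCons monom_0)
next
  fix n :: nat assume "n > 0"
  then obtain n' where n: "n = Suc n'" by (cases n) auto
  have "subst_y_neg_x (explicit_s_power s n)
      = (\<Sum>k\<le>n. monom (to_tfrac (s_binom s n k * signed_s_power01 s k)) n)"
    unfolding explicit_s_power_def subst_y_neg_x_sum subst_y_neg_x_monom
  proof (intro sum.cong refl)
    fix k assume "k \<in> {..n}"
    moreover have "(- 1) ^ k * to_tfrac (s_binom s n k * ((- 1) ^ k * signed_s_power01 s k))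
        = to_tfrac (s_binom s n k * signed_s_power01 s k)"
      by (simp add: to_tfrac_mult to_tfrac_power to_tfrac_minus mult.left_commute flip: power_add mult_2)
    ultimately show "monom ((- 1) ^ k * to_tfrac (s_binom s n k * ((- 1) ^ k * signed_s_power01 s k))) (k + (n - k))
        = monom (to_tfrac (s_binom s n k * signed_s_power01 s k)) n" by simp
  qed
  also have "\<dots> = monom (to_tfrac (\<Sum>k\<le>n. s_binom s n k * signed_s_power01 s k)) n"
    by (rule poly_eqI) (simp add: coeff_sum to_tfrac_sum)
  also have "(\<Sum>k\<le>n. s_binom s n k * signed_s_power01 s k) = 0"
    using gns by (simp add: n)
  finally show "subst_y_neg_x (explicit_s_power s n) = 0" by simp
next
  fix n :: nat assume "n > 0"
  then obtain n' where n: "n = Suc n'" by (cases n) auto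
  show "nabla s (explicit_s_power s n) = const2 (to_tfrac (s n)) * explicit_s_power s (n - 1)"
  proof (rule poly_eqI)
    fix i
    have "s (Suc i) * s_binom s (Suc n') (n' - i) = s (Suc n') * s_binom s n' (n' - i)" if "i \<le> n'"
      using s_binom_absorb_comp[OF gns, of "n' - i" n'] that by (simp add: Suc_diff_le mult.commute)
    then show "coeff (nabla s (explicit_s_power s n)) i
        = coeff (const2 (to_tfrac (s n)) * explicit_s_power s (n - 1)) i"
      by (auto simp: coeff_nabla coeff_explicit_s_power n const2_def smult_monom
            mult.assoc[symmetric] simp flip: to_tfrac_mult)
  qed
qed

lemma s_power_eq:
  assumes "gns s"
  shows "s_power s = explicit_s_power s"
  unfolding s_power_def
proof (rule the_equality)
  show "is_s_powers s (explicit_s_power s)" by (rule is_s_powers_explicit_s_power[OF assms])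
  then show "P = explicit_s_power s" if "is_s_powers s P" for P
    using is_s_powers_unique[OF assms that] by blast
qed

lemma s_power01_eq:
  assumes "gns s"
  shows "s_power01 s k = to_tfrac ((- 1) ^ k * signed_s_power01 s k)"
  using assms
  by (simp add: s_power01_def eval2_def s_power_eq poly_0_coeff_0 coeff_explicit_s_power poly_monom)

lemma s_binomial_theorem:
  fixes s :: "nat \<Rightarrow> 'a::comm_ring_1"
  assumes "gns s"
  shows "s_power s n =
    (\<Sum>k=0..n. const2 (to_tfrac (s_binom s n k)) * varx ^ (n - k) * vary ^ k * const2 (s_power01 s k))"
proof -
  have x: "(varx :: 'a tfrac poly2) ^ i = monom 1 i" for i
    by (simp add: varx_def monom_altdef)
  have y: "(vary :: 'a tfrac poly2) ^ i = [:monom 1 i:]" for i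
    by (simp add: vary_def monom_altdef poly_const_pow)
  have "monom (monom (to_tfrac (s_binom s n k * ((- 1) ^ k * signed_s_power01 s k))) k) (n - k)
      = const2 (to_tfrac (s_binom s n k)) * varx ^ (n - k) * vary ^ k * const2 (s_power01 s k)" for k
    by (simp add: x y const2_def s_power01_eq[OF assms] smult_monom to_tfrac_mult mult_ac)
  then show ?thesis
    by (simp add: s_power_eq[OF assms] explicit_s_power_def atLeast0AtMost)
qed


section \<open>The Lucas theorem\<close>

text \<open>Congruence modulo a principal ideal. In an arbitrary commutative ring there is no division with
  remainder, so it cannot be expressed as equality of residues.\<close>

definition cong_mod :: "'a::comm_ring_1 \<Rightarrow> 'a \<Rightarrow> 'a \<Rightarrow> bool" where
  "cong_mod q a b \<longleftrightarrow> q dvd a - b"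

lemma cong_mod_refl [simp]: "cong_mod q a a"
  by (simp add: cong_mod_def)

lemma cong_mod_sym: "cong_mod q a b \<Longrightarrow> cong_mod q b a"
  unfolding cong_mod_def using dvd_minus_iff[of q "a - b"] by simp

lemma cong_mod_trans [trans]: "cong_mod q a b \<Longrightarrow> cong_mod q b c \<Longrightarrow> cong_mod q a c"
  unfolding cong_mod_def using dvd_add[of q "a - b" "b - c"] by simp

lemma cong_mod_add: "cong_mod q a b \<Longrightarrow> cong_mod q c d \<Longrightarrow> cong_mod q (a + c) (b + d)"
  unfolding cong_mod_def using dvd_add[of q "a - b" "c - d"] by (simp add: algebra_simps)

lemma cong_mod_diff: "cong_mod q a b \<Longrightarrow> cong_mod q c d \<Longrightarrow> cong_mod q (a - c) (b - d)"
  unfolding cong_mod_def using dvd_diff[of q "a - b" "c - d"] by (simp add: algebra_simps)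

lemma cong_mod_mult:
  assumes "cong_mod q a b" "cong_mod q c d"
  shows "cong_mod q (a * c) (b * d)"
proof -
  have "a * c - b * d = (a - b) * c + b * (c - d)" by (simp add: algebra_simps)
  with assms show ?thesis unfolding cong_mod_def by simp
qed

context
  fixes s :: "nat \<Rightarrow> 'a::comm_ring_1"
  assumes gns: "gns s"
    and s_1: "s 1 = 1"
    and s_add: "\<And>a b. a > 0 \<Longrightarrow> b > 0 \<Longrightarrow> s a * s b dvd s (a + b) - (s a + s b)"
begin

text \<open>The subtractive Euclidean algorithm. Since \<open>s (a + b)\<close> equals \<open>s a + s b\<close> up to a multiple of
  \<open>s a * s b\<close>, the value \<open>s b\<close> lies in the ideal generated by \<open>s a\<close> and \<open>s (a + b)\<close>, so a combination
  for the smaller pair becomes one for the larger pair.\<close>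

lemma s_bezout: "\<exists>u v. u * s a + v * s b = s (gcd a b)"
proof (induction "a + b" arbitrary: a b rule: less_induct)
  case less
  have step: "\<exists>u v. u * s a + v * s b = s (gcd a b)"
    if ab: "0 < a" "a < b" and IH: "\<exists>u v. u * s a + v * s (b - a) = s (gcd a (b - a))" for a b
  proof -
    obtain t where "s b - (s a + s (b - a)) = s a * s (b - a) * t"
      using s_add[of a "b - a"] ab by auto
    then have t: "s (b - a) = s b - s a * (1 + s (b - a) * t)" by (simp add: algebra_simps)
    obtain u v where uv: "u * s a + v * s (b - a) = s (gcd a (b - a))" using IH by blast
    have "s (gcd a b) = u * s a + v * s (b - a)"
      using uv ab by (metis gcd_diff1_nat gcd.commute less_imp_le)
    also have "\<dots> = u * s a + v * (s b - s a * (1 + s (b - a) * t))"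
      by (subst t) (rule refl)
    also have "\<dots> = (u - v * (1 + s (b - a) * t)) * s a + v * s b"
      by (simp add: algebra_simps)
    finally show ?thesis by metis
  qed
  consider "a = 0" | "b = 0" | "a = b" | "0 < a" "a < b" | "0 < b" "b < a" by linarith
  then show ?case
  proof cases
    case 1
    then show ?thesis by (intro exI[of _ 0] exI[of _ 1]) simp
  next
    case 2
    then show ?thesis by (intro exI[of _ 1] exI[of _ 0]) simp
  next
    case 3
    then show ?thesis by (intro exI[of _ 1] exI[of _ 0]) simp
  next
    case 4
    then have "\<exists>u v. u * s a + v * s (b - a) = s (gcd a (b - a))" by (intro less) auto
    with 4 show ?thesis by (rule step)
  next
    case 5
    then have "\<exists>u v. u * s b + v * s (a - b) = s (gcd b (a - b))" by (intro less) auto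
    with 5 have "\<exists>u v. u * s b + v * s a = s (gcd b a)" by (rule step)
    then show ?thesis by (metis add.commute gcd.commute)
  qed
qed

lemma cong_s_add_mult: "cong_mod (s p) (s (m * p + a)) (s a)"
proof (induction m)
  case (Suc m)
  have "s p dvd s (p + (m * p + a)) - s (m * p + a)"
    using gns_dvd_diff[OF gns, of "m * p + a" "p + (m * p + a)"] by (cases "p = 0") auto
  then have "cong_mod (s p) (s (Suc m * p + a)) (s (m * p + a))"
    by (simp add: cong_mod_def add.assoc)
  then show ?case using Suc by (rule cong_mod_trans)
qed simp

text \<open>Dividing the hypothesis \<open>s n = s k + s (n - k) + s k * s (n - k) * t\<close> by \<open>s (n - k)\<close> shows that
  the quotient is \<open>1 + s k * t\<close>. This covers the case that \<open>s (n - k)\<close> is not invertible modulo \<open>s p\<close>.\<close>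

lemma s_quot_cong_1:
  assumes "0 < k" "k < n"
  shows "cong_mod (s k) (s_quot s n k) 1"
proof -
  obtain t where t: "s n - (s k + s (n - k)) = s k * s (n - k) * t"
    using s_add[of k "n - k"] assms by auto
  have "s (n - k) * s_quot s n k = s (n - k) * (1 + s k * t)"
    using t s_quot_mult[OF gns assms(2)] by (simp add: algebra_simps)
  then have "s_quot s n k = 1 + s k * t"
    using nonzerodiv_cancel gns_nonzerodiv[OF gns] assms by (metis zero_less_diff)
  then show ?thesis by (simp add: cong_mod_def)
qed

context
  fixes p :: nat
  assumes prime: "prime p"
begin

text \<open>By \<open>s_bezout\<close> and \<open>s 1 = 1\<close>, \<open>s a\<close> is invertible modulo \<open>s p\<close>.\<close>

lemma cong_mod_cancel_s:
  assumes "0 < a" "a < p" "cong_mod (s p) (s a * x) (s a * y)"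
  shows "cong_mod (s p) x y"
proof -
  have "coprime a p"
    using assms prime by (metis coprime_commute nat_dvd_not_less prime_imp_coprime)
  then obtain u v where uv: "u * s a + v * s p = 1"
    using s_bezout[of a p] s_1 by (auto simp: coprime_iff_gcd_eq_1)
  have "x - y = (u * s a + v * s p) * (x - y)" by (simp add: uv)
  also have "\<dots> = u * (s a * x - s a * y) + s p * (v * (x - y))"
    by (simp add: algebra_simps)
  finally show ?thesis
    using assms(3) unfolding cong_mod_def by (metis dvd_add dvd_mult dvd_triv_left)
qed

text \<open>Both quotients solve \<open>s (n - k) * z = s n - s k\<close> modulo \<open>s p\<close>, where \<open>s (n - k)\<close> is invertible
  because \<open>0 < n - k < p\<close>. The binomial coefficient by which the quotient is multiplied in Pascal's
  identity is kept as a factor: it vanishes when \<open>b * p + k\<close> is not below \<open>a * p + n\<close>, where the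
  quotient on the left has no meaning. Allowing \<open>n = p\<close> serves the step across a multiple of \<open>p\<close>.\<close>

lemma s_quot_mult_s_binom_cong:
  assumes "k < n" "n - k < p"
  shows "cong_mod (s p)
    (s_quot s (a * p + n) (b * p + k) * s_binom s (a * p + n - 1) (b * p + k))
    (s_quot s n k * s_binom s (a * p + n - 1) (b * p + k))"
proof (cases "b * p + k < a * p + n")
  case False
  then show ?thesis using assms by (simp add: s_binom_eq_0)
next
  case True
  let ?N = "a * p + n" and ?K = "b * p + k"
  have "b * p < Suc a * p" using True assms by simp
  then have "b \<le> a" by (metis mult_less_cancel2 less_Suc_eq_le)
  then obtain d where d: "a = b + d" using le_Suc_ex by blast
  then have diff: "?N - ?K = d * p + (n - k)" using assms by (simp add: algebra_simps)
  have "cong_mod (s p) (s (n - k) * s_quot s ?N ?K) (s (?N - ?K) * s_quot s ?N ?K)"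
    unfolding diff by (intro cong_mod_mult cong_mod_refl cong_mod_sym[OF cong_s_add_mult])
  also have "s (?N - ?K) * s_quot s ?N ?K = s ?N - s ?K"
    using s_quot_mult[OF gns True] by (simp add: mult.commute)
  also have "cong_mod (s p) \<dots> (s n - s k)"
    by (intro cong_mod_diff cong_s_add_mult)
  also have "s n - s k = s (n - k) * s_quot s n k"
    using s_quot_mult[OF gns assms(1)] by (simp add: mult.commute)
  finally have "cong_mod (s p) (s_quot s ?N ?K) (s_quot s n k)"
    by (rule cong_mod_cancel_s[rotated 2]) (use assms in auto)
  then show ?thesis by (intro cong_mod_mult cong_mod_refl)
qed

lemma s_binom_prime_cong_0:
  assumes "0 < k" "k < p"
  shows "cong_mod (s p) (s_binom s p k) 0"
proof (rule cong_mod_cancel_s[OF assms])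
  have "s_binom s p k * s k = s p * s_binom s (p - 1) (k - 1)"
    using s_binom_absorb[OF gns, of "p - 1" "k - 1"] assms by simp
  then show "cong_mod (s p) (s k * s_binom s p k) (s k * 0)"
    by (simp add: cong_mod_def mult.commute)
qed

text \<open>The Lucas congruence for the row \<open>n1 * p + n0\<close> of the s-Pascal triangle. Pascal's identity refers
  to entries of the preceding row in different columns, so a whole row is treated at once.\<close>

abbreviation lucas_row :: "nat \<Rightarrow> nat \<Rightarrow> bool" where
  "lucas_row n1 n0 \<equiv> \<forall>k1 k0. k0 < p \<longrightarrow>
     cong_mod (s p) (s_binom s (n1 * p + n0) (k1 * p + k0))
       (of_nat (n1 choose k1) * s_binom s n0 k0)"

lemma p_pos: "0 < p"
  using prime by (simp add: prime_gt_0_nat)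

lemma lucas_row_first:
  assumes "n0 < p"
  shows "lucas_row 0 n0"
proof (intro allI impI)
  fix k1 k0 assume "k0 < p"
  show "cong_mod (s p) (s_binom s (0 * p + n0) (k1 * p + k0)) (of_nat (0 choose k1) * s_binom s n0 k0)"
  proof (cases k1)
    case (Suc b)
    then have "n0 < k1 * p + k0" using assms by simp
    then show ?thesis using Suc by (simp add: s_binom_eq_0)
  qed simp
qed

text \<open>The step within a block of \<open>p\<close> rows. In a column divisible by \<open>p\<close>, the left neighbour above has
  column residue \<open>p - 1\<close>, which exceeds the residue of its row, so it contributes 0. In the other
  columns \<open>p\<close> does not enter and the recursion is that for \<open>s_binom s (Suc n0) k0\<close>; its second
  coefficient is known modulo \<open>s p\<close> only if \<open>k0 < Suc n0\<close>, but otherwise it multiplies 0.\<close>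

lemma lucas_row_Suc:
  assumes row: "lucas_row n1 n0" and n0: "Suc n0 < p"
  shows "lucas_row n1 (Suc n0)"
proof (intro allI impI)
  fix k1 k0 assume k0: "k0 < p"
  let ?M = "n1 * p + n0" and ?K = "k1 * p + k0" and ?C = "of_nat (n1 choose k1) :: 'a"
  let ?c = "s_quot s (Suc ?M) ?K"
  show "cong_mod (s p) (s_binom s (n1 * p + Suc n0) ?K) (?C * s_binom s (Suc n0) k0)"
  proof (cases k0)
    case 0
    show ?thesis
    proof (cases k1)
      case 0
      then show ?thesis using \<open>k0 = 0\<close> gns by simp
    next
      case (Suc b)
      then have K: "?K = Suc (b * p + (p - 1))" using \<open>k0 = 0\<close> p_pos by simp
      have left: "cong_mod (s p) (s_binom s ?M (b * p + (p - 1))) 0"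
        using row[rule_format, of "p - 1" b] n0 by (simp add: s_binom_eq_0)
      have "cong_mod (s p) (?c * s_binom s ?M ?K) (1 * s_binom s ?M ?K)"
        using s_quot_mult_s_binom_cong[of 0 "Suc n0" n1 k1] n0 \<open>k0 = 0\<close> s_quot_0[OF gns] by simp
      also have "cong_mod (s p) \<dots> ?C"
        using row[rule_format, OF k0, of k1] \<open>k0 = 0\<close> gns by simp
      finally have "cong_mod (s p) (s_binom s ?M (b * p + (p - 1)) + ?c * s_binom s ?M ?K) (0 + ?C)"
        by (intro cong_mod_add left)
      then show ?thesis
        using s_pascal[OF gns, of ?M "b * p + (p - 1)"] K \<open>k0 = 0\<close> gns by simp
    qed
  next
    case (Suc k)
    have left: "cong_mod (s p) (s_binom s ?M (k1 * p + k)) (?C * s_binom s n0 k)"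
      using row k0 Suc by simp
    have right: "cong_mod (s p) (?c * s_binom s ?M ?K)
        (s_quot s (Suc n0) (Suc k) * (?C * s_binom s n0 (Suc k)))"
    proof (cases "k < n0")
      case True
      have "cong_mod (s p) (?c * s_binom s ?M ?K) (s_quot s (Suc n0) (Suc k) * s_binom s ?M ?K)"
        using s_quot_mult_s_binom_cong[of "Suc k" "Suc n0" n1 k1] n0 Suc True by simp
      also have "cong_mod (s p) \<dots> (s_quot s (Suc n0) (Suc k) * (?C * s_binom s n0 (Suc k)))"
        using row[rule_format, OF k0, of k1] Suc by (intro cong_mod_mult cong_mod_refl) simp
      finally show ?thesis .
    next
      case False
      then have "cong_mod (s p) (s_binom s ?M ?K) 0"
        using row[rule_format, OF k0, of k1] Suc by (simp add: s_binom_eq_0)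
      then have "cong_mod (s p) (?c * s_binom s ?M ?K) (?c * 0)"
        by (intro cong_mod_mult cong_mod_refl)
      then show ?thesis using False by (simp add: s_binom_eq_0)
    qed
    show ?thesis
      using cong_mod_add[OF left right] s_pascal[OF gns, of ?M "k1 * p + k"]
        s_pascal[OF gns, of n0 k] Suc
      by (simp add: algebra_simps)
  qed
qed

text \<open>The step to a row divisible by \<open>p\<close>. In a column divisible by \<open>p\<close>, both neighbours above count and
  the coefficient is 1 modulo \<open>s p\<close>, which leaves the ordinary Pascal identity. In any other column
  the two neighbours add up to a multiple of \<open>s_binom s p k0\<close>, which vanishes modulo \<open>s p\<close>.\<close>

lemma lucas_row_carry:
  assumes row: "lucas_row n1 (p - 1)"
  shows "lucas_row (Suc n1) 0"
proof (intro allI impI)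
  fix k1 k0 assume k0: "k0 < p"
  let ?M = "n1 * p + (p - 1)" and ?K = "k1 * p + k0" and ?C = "of_nat (n1 choose k1) :: 'a"
  let ?c = "s_quot s (Suc ?M) ?K"
  have N: "Suc n1 * p + 0 = Suc ?M" "n1 * p + p = Suc ?M" using p_pos by simp_all
  show "cong_mod (s p) (s_binom s (Suc n1 * p + 0) ?K) (of_nat (Suc n1 choose k1) * s_binom s 0 k0)"
  proof (cases k0)
    case 0
    show ?thesis
    proof (cases k1)
      case 0
      then show ?thesis using \<open>k0 = 0\<close> gns by simp
    next
      case (Suc b)
      then have K: "?K = Suc (b * p + (p - 1))" using \<open>k0 = 0\<close> p_pos by simp
      have left: "cong_mod (s p) (s_binom s ?M (b * p + (p - 1))) (of_nat (n1 choose b))"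
        using row[rule_format, of "p - 1" b] p_pos gns by simp
      have "cong_mod (s p) (?c * s_binom s ?M ?K) (1 * s_binom s ?M ?K)"
      proof (cases "?K < Suc ?M")
        case True
        have "cong_mod (s ?K) ?c 1"
          using s_quot_cong_1[OF _ True] K by simp
        moreover have "s p dvd s ?K"
          using cong_s_add_mult[of p k1 0] \<open>k0 = 0\<close> gns by (simp add: cong_mod_def)
        ultimately have "cong_mod (s p) ?c 1"
          unfolding cong_mod_def by (rule dvd_trans[rotated])
        then show ?thesis by (intro cong_mod_mult cong_mod_refl)
      next
        case False
        then show ?thesis by (simp add: s_binom_eq_0)
      qed
      also have "cong_mod (s p) \<dots> ?C"
        using row[rule_format, OF k0, of k1] \<open>k0 = 0\<close> gns by simp
      finally have "cong_mod (s p) (s_binom s ?M (b * p + (p - 1)) + ?c * s_binom s ?M ?K)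
          (of_nat (n1 choose b) + ?C)"
        by (intro cong_mod_add left)
      then show ?thesis
        unfolding N K using s_pascal[OF gns, of ?M "b * p + (p - 1)"] K \<open>k0 = 0\<close> Suc gns
        by simp
    qed
  next
    case (Suc k)
    have left: "cong_mod (s p) (s_binom s ?M (k1 * p + k)) (?C * s_binom s (p - 1) k)"
      using row k0 Suc by simp
    have "cong_mod (s p) (?c * s_binom s ?M ?K) (s_quot s p k0 * s_binom s ?M ?K)"
      using s_quot_mult_s_binom_cong[of k0 p n1 k1] k0 Suc unfolding N(2) by simp
    also have "cong_mod (s p) \<dots> (s_quot s p k0 * (?C * s_binom s (p - 1) k0))"
      using row[rule_format, OF k0] by (intro cong_mod_mult cong_mod_refl)
    finally have "cong_mod (s p) (s_binom s ?M (k1 * p + k) + ?c * s_binom s ?M ?K)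
        (?C * s_binom s (p - 1) k + s_quot s p k0 * (?C * s_binom s (p - 1) k0))"
      by (intro cong_mod_add left)
    also have "\<dots> = ?C * s_binom s p k0"
      using s_pascal[OF gns, of "p - 1" k] p_pos Suc by (simp add: algebra_simps)
    also have "cong_mod (s p) \<dots> (?C * 0)"
      using s_binom_prime_cong_0[of k0] k0 Suc by (intro cong_mod_mult cong_mod_refl) simp
    finally show ?thesis
      unfolding N using s_pascal[OF gns, of ?M "k1 * p + k"] Suc
      by (simp add: s_binom_eq_0)
  qed
qed

lemma s_lucas: "n0 < p \<Longrightarrow> lucas_row n1 n0"
proof (induction n1 arbitrary: n0)
  case 0
  then show ?case by (rule lucas_row_first)
next
  case (Suc n1)
  have "lucas_row (Suc n1) 0"
    using lucas_row_carry[OF Suc.IH[of "p - 1"]] p_pos by simp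
  with Suc.prems show ?case
  proof (induction n0)
    case (Suc n0)
    then show ?case using lucas_row_Suc[of "Suc n1" n0] by simp
  qed
qed

end

end


theorem theorem1:
  fixes s :: "nat \<Rightarrow> 'a::comm_ring_1"
  assumes "gns s"
  shows
    "(\<forall>n k. n > k \<and> k > 0 \<longrightarrow>
        s_binom s n k = s_binom s (n - 1) (k - 1) + s_quot s n k * s_binom s (n - 1) k)
     \<and>
     (\<forall>n. s_power s n =
        (\<Sum>k=0..n. const2 (to_tfrac (s_binom s n k)) * varx ^ (n - k) * vary ^ k
                     * const2 (s_power01 s k)))
     \<and>
     (s 1 = 1 \<and> (\<forall>a>0. \<forall>b>0. s a * s b dvd s (a + b) - (s a + s b)) \<longrightarrow>
        (\<forall>p n1 n0 k1 k0 :: nat. prime p \<and> n0 < p \<and> k0 < p \<longrightarrow>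
           s p dvd s_binom s (n1 * p + n0) (k1 * p + k0)
                     - of_nat (n1 choose k1) * s_binom s n0 k0))
     \<and>
     (\<forall>m n k. k \<le> m + n \<longrightarrow>
        s_binom s (m + n) k =
          (\<Sum>j | j \<le> n \<and> j \<le> k \<and> k - j \<le> m. s_binom s m (k - j) * s_vander s n j m k))"
proof (intro conjI allI impI)
  fix n k :: nat assume "n > k \<and> k > 0"
  then show "s_binom s n k = s_binom s (n - 1) (k - 1) + s_quot s n k * s_binom s (n - 1) k"
    using s_pascal[OF assms, of "n - 1" "k - 1"] by simp
next
  fix p n1 n0 k1 k0 :: nat
  assume "s 1 = 1 \<and> (\<forall>a>0. \<forall>b>0. s a * s b dvd s (a + b) - (s a + s b))"
    and "prime p \<and> n0 < p \<and> k0 < p"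
  then show "s p dvd s_binom s (n1 * p + n0) (k1 * p + k0)
      - of_nat (n1 choose k1) * s_binom s n0 k0"
    using s_lucas[OF assms, of p n0 n1] unfolding cong_mod_def by blast
qed (rule s_binomial_theorem[OF assms] s_vandermonde[OF assms])+

end
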